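(* Let $G$ be an acyclic network with a multicast connection $\mathcal C=\{(S,T_1,\mathcal X(S)),(S,T_2,\mathcal X(S)),\dots,(S,T_N,\mathcal X(S))\}$ ($T_i\neq S$), and let $\mathcal F$ be the set of all link failure patterns $f$ such that $(G_f,\mathcal C)$ is solvable. Then there exists a static solution to the problem $(G_f,\mathcal C)$ for all $f\in\mathcal F$; that is, over some finite field (extension of the base field) there is a single assignment of the coefficients $\alpha_{(i,e_j)}$, $\epsilon_{(e_i,(T_j,k))}$, $\beta_{(e_i,e_j)}$, not depending on $f$, such that for every $f\in\mathcal F$ and every $i\in\{1,\dots,N\}$ the system matrix of $G_f$ from $\mathcal X(S)$ to $\mathcal Z(T_i)$ is invertible.
   Context: Network. $G=(\mathcal V,\mathcal E)$ consists of a finite set $\mathcal V$ of nodes; each node $V$ has a finite set $I(V)$ of input ports and a finite set $O(V)$ of output ports (all pairwise disjoint). Each edge in $\mathcal E$ is an ordered pair $(e_1,e_2)$ with $e_1\in O(V_1)$ and $e_2\in I(V_2)$ for some $V_1,V_2\in\mathcal V$. $G$ is acyclic if the directed graph on $\mathcal V$ with an arc $V_1\to V_2$ whenever some edge goes from $O(V_1)$ to $I(V_2)$ has no directed cycle. Linear transmission over a finite field. The source $S$ has independent symbols $\mathcal X(S)=[X(S,1),\dots,X(S,\mu(S))]$, $\mu(S)=|\mathcal X(S)|\le|O(S)|$. $Y(e)$ denotes the symbol at port $e$. For $e\in O(V)$: $Y(e)=\sum_{e'\in I(V)}\beta_{(e',e)}Y(e')$, plus $\sum_i\alpha_{(i,e)}X(S,i)$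 if $V=S$. For an input port $e'$: $Y(e')=\sum_{(e,e')\in\mathcal E}Y(e)$. Each destination $T_i$ forms $\mathcal Z(T_i)=[Z(T_i,1),\dots,Z(T_i,\mu(S))]$ with $Z(T_i,k)=\sum_{e'\in I(T_i)}\epsilon_{(e',(T_i,k))}Y(e')$. The coefficients $\alpha,\beta,\epsilon$ are free. The system matrix from $\mathcal X(S)$ to $\mathcal Z(T_i)$ is the $\mu(S)\times\mu(S)$ matrix $M_i$ with $\mathcal Z(T_i)=\mathcal X(S)M_i$. Solvability. A base finite field $\mathbb F_q$ is given; the field size is not restricted, so $(G,\mathcal C)$ is called solvable if for some finite extension field of $\mathbb F_q$ (with symbols, coefficients and additions in it) the coefficients can be chosen so that $\mathcal Z(T_i)=\mathcal X(S)$ for all $i$ simultaneously and all values of the source symbols. Failures. A link failure pattern $f$ is a set of failing edges; $G_f$ is the network obtained from $G$ by deleting the edges in $f$ (nodes and ports, hence the coding coefficients, are unchanged). *)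

theory Defs
  imports
    "HOL-Library.Disjoint_Sets"
    "HOL-Algebra.Algebraic_Closure_Type"
    "Jordan_Normal_Form.Matrix"
begin

section \<open>Networks\<close>

record ('v, 'p) network =
  nodes :: "'v set"
  in_ports :: "'v \<Rightarrow> 'p set"
  out_ports :: "'v \<Rightarrow> 'p set"
  edges :: "('p \<times> 'p) set"

definition arcs :: "('v, 'p) network \<Rightarrow> ('v \<times> 'v) set" where
  "arcs G = {(v, w). v \<in> nodes G \<and> w \<in> nodes G \<and>
     (\<exists>(e, e') \<in> edges G. e \<in> out_ports G v \<and> e' \<in> in_ports G w)}"

locale network =
  fixes G :: "('v, 'p) network"
  assumes finite_nodes: "finite (nodes G)"
    and finite_in_ports: "v \<in> nodes G \<Longrightarrow> finite (in_ports G v)"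
    and finite_out_ports: "v \<in> nodes G \<Longrightarrow> finite (out_ports G v)"
    and disjoint_in_ports: "disjoint_family_on (in_ports G) (nodes G)"
    and disjoint_out_ports: "disjoint_family_on (out_ports G) (nodes G)"
    and disjoint_in_out_ports:
      "\<lbrakk>v \<in> nodes G; w \<in> nodes G\<rbrakk> \<Longrightarrow> in_ports G v \<inter> out_ports G w = {}"
    and edges_ports:
      "edges G \<subseteq> (\<Union>v \<in> nodes G. out_ports G v) \<times> (\<Union>w \<in> nodes G. in_ports G w)"

locale acyclic_network = network +
  assumes acyclic_arcs: "acyclic (arcs G)"

definition delete_edges :: "('p \<times> 'p) set \<Rightarrow> ('v, 'p) network \<Rightarrow> ('v, 'p) network" where
  "delete_edges f G = G\<lparr>edges := edges G - f\<rparr>"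

text \<open>
  The destinations are \<open>T 1, \<dots>, T N\<close>, and \<open>\<mu>\<close> is the number of source symbols.
\<close>

locale multicast = acyclic_network G
  for G :: "('v, 'p) network" and S :: 'v and \<mu> :: nat and T :: "nat \<Rightarrow> 'v" and N :: nat +
  assumes source_node: "S \<in> nodes G"
    and source_symbols: "\<mu> \<le> card (out_ports G S)"
    and destination_node: "i \<in> {1..N} \<Longrightarrow> T i \<in> nodes G"
    and destination_not_source: "i \<in> {1..N} \<Longrightarrow> T i \<noteq> S"


section \<open>Finite extension fields\<close>

text \<open>
  The base field \<open>\<bbbF>\<^sub>q\<close> is a type \<open>'q\<close> of class \<^class>\<open>finite_field\<close>. One cannot quantify over types,
  so its finite extension fields are taken inside its algebraic closure: every finite extension
  of \<open>\<bbbF>\<^sub>q\<close> is isomorphic over \<open>\<bbbF>\<^sub>q\<close> to a finite subfield of the closure that contains \<open>\<bbbF>\<^sub>q\<close>.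
\<close>

definition finite_extension_field :: "'q::finite_field alg_closure set \<Rightarrow> bool" where
  "finite_extension_field K \<longleftrightarrow> subfield K ring_of_type_algebra \<and> range to_ac \<subseteq> K \<and> finite K"


section \<open>Linear transmission\<close>

text \<open>
  Source symbols and received symbols are numbered from 0, as are the entries of vectors and
  matrices. Values of the coefficient functions at arguments that do not occur in the
  transmission equations are irrelevant.
\<close>

record ('v, 'p, 'k) coding =
  src_coeff :: "nat \<times> 'p \<Rightarrow> 'k"           (* alpha *)
  node_coeff :: "'p \<times> 'p \<Rightarrow> 'k"           (* beta *)
  dest_coeff :: "'p \<times> ('v \<times> nat) \<Rightarrow> 'k"    (* epsilon *)

definition coding_over :: "'k set \<Rightarrow> ('v, 'p, 'k) coding \<Rightarrow> bool" where
  "coding_over K c \<longleftrightarrow>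
     range (src_coeff c) \<subseteq> K \<and> range (node_coeff c) \<subseteq> K \<and> range (dest_coeff c) \<subseteq> K"

definition transmission ::
  "('v, 'p) network \<Rightarrow> 'v \<Rightarrow> ('v, 'p, 'k::comm_ring_1) coding \<Rightarrow> 'k vec \<Rightarrow> ('p \<Rightarrow> 'k) \<Rightarrow> bool"
where
  "transmission G S c x Y \<longleftrightarrow>
     (\<forall>v \<in> nodes G. \<forall>e \<in> out_ports G v.
        Y e = (\<Sum>e' \<in> in_ports G v. node_coeff c (e', e) * Y e') +
              (if v = S then \<Sum>i < dim_vec x. src_coeff c (i, e) * x $ i else 0)) \<and>
     (\<forall>v \<in> nodes G. \<forall>e' \<in> in_ports G v. Y e' = (\<Sum>e \<in> {e. (e, e') \<in> edges G}. Y e)) \<and>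
     (\<forall>p. p \<notin> (\<Union>v \<in> nodes G. in_ports G v \<union> out_ports G v) \<longrightarrow> Y p = 0)"

text \<open>
  In an acyclic network the transmission equations determine the port symbols
  (\<open>acyclic_network.ex1_transmission\<close> below), so the following description is well-defined.
\<close>

definition port_symbols ::
  "('v, 'p) network \<Rightarrow> 'v \<Rightarrow> ('v, 'p, 'k::comm_ring_1) coding \<Rightarrow> 'k vec \<Rightarrow> 'p \<Rightarrow> 'k"
where
  "port_symbols G S c x = (THE Y. transmission G S c x Y)"

definition received ::
  "('v, 'p) network \<Rightarrow> 'v \<Rightarrow> ('v, 'p, 'k::comm_ring_1) coding \<Rightarrow> 'v \<Rightarrow> 'k vec \<Rightarrow> 'k vec"
where
  "received G S c t x = vec (dim_vec x)
     (\<lambda>k. \<Sum>e' \<in> in_ports G t. dest_coeff c (e', (t, k)) * port_symbols G S c x e')"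

text \<open>
  \<open>M\<^sup>T *\<^sub>v x\<close> is the product \<open>x M\<close> of the row vector \<open>x\<close> with \<open>M\<close>. The unit vectors have entries
  in \<open>K\<close>, so there is at most one such \<open>M\<close>.
\<close>

definition is_system_matrix ::
  "'k::comm_ring_1 set \<Rightarrow> ('v, 'p) network \<Rightarrow> 'v \<Rightarrow> nat \<Rightarrow> ('v, 'p, 'k) coding \<Rightarrow> 'v \<Rightarrow> 'k mat \<Rightarrow> bool"
where
  "is_system_matrix K G S \<mu> c t M \<longleftrightarrow>
     M \<in> carrier_mat \<mu> \<mu> \<and> elements_mat M \<subseteq> K \<and>
     (\<forall>x \<in> carrier_vec \<mu>. set\<^sub>v x \<subseteq> K \<longrightarrow> received G S c t x = M\<^sup>T *\<^sub>v x)"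

definition solvable ::
  "'q::finite_field itself \<Rightarrow> ('v, 'p) network \<Rightarrow> 'v \<Rightarrow> nat \<Rightarrow> (nat \<Rightarrow> 'v) \<Rightarrow> nat \<Rightarrow> bool"
where
  "solvable _ G S \<mu> T N \<longleftrightarrow>
     (\<exists>(K :: 'q alg_closure set) c. finite_extension_field K \<and> coding_over K c \<and>
        (\<forall>i \<in> {1..N}. \<forall>x \<in> carrier_vec \<mu>. set\<^sub>v x \<subseteq> K \<longrightarrow> received G S c (T i) x = x))"

definition solvable_failures ::
  "'q::finite_field itself \<Rightarrow> ('v, 'p) network \<Rightarrow> 'v \<Rightarrow> nat \<Rightarrow> (nat \<Rightarrow> 'v) \<Rightarrow> nat \<Rightarrow>
     ('p \<times> 'p) set set"
where
  "solvable_failures q G S \<mu> T N = {f. f \<subseteq> edges G \<and> solvable q (delete_edges f G) S \<mu> T N}"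


section \<open>Well-definedness of the port symbols\<close>

lemma (in network) network_delete_edges: "network (delete_edges f G)"
  using finite_nodes finite_in_ports finite_out_ports disjoint_in_ports disjoint_out_ports
    disjoint_in_out_ports edges_ports
  by unfold_locales (auto simp: delete_edges_def)

lemma (in acyclic_network) acyclic_network_delete_edges: "acyclic_network (delete_edges f G)"
proof -
  interpret D: network "delete_edges f G" by (rule network_delete_edges)
  have "arcs (delete_edges f G) \<subseteq> arcs G"
    by (force simp: arcs_def delete_edges_def)
  then show ?thesis
    using acyclic_arcs acyclic_subset by unfold_locales blast
qed

lemma (in acyclic_network) wf_arcs: "wf (arcs G)"
proof (rule finite_acyclic_wf)
  show "finite (arcs G)"
    by (rule finite_subset[of _ "nodes G \<times> nodes G"]) (auto simp: arcs_def finite_nodes)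
qed (rule acyclic_arcs)

lemma (in network) edge_source:
  assumes "(e, e') \<in> edges G" "w \<in> nodes G" "e' \<in> in_ports G w"
  obtains v where "v \<in> nodes G" "e \<in> out_ports G v" "(v, w) \<in> arcs G"
proof -
  obtain v where v: "v \<in> nodes G" "e \<in> out_ports G v"
    using assms(1) edges_ports by blast
  then have "(v, w) \<in> arcs G"
    using assms by (auto simp: arcs_def)
  with v show ?thesis by (rule that)
qed

lemma (in network) finite_edge_sources: "finite {e. (e, e') \<in> edges G}"
proof (rule finite_subset)
  show "{e. (e, e') \<in> edges G} \<subseteq> (\<Union>v \<in> nodes G. out_ports G v)"
    using edges_ports by blast
qed (use finite_nodes finite_out_ports in blast)

theorem (in acyclic_network) ex1_transmission: "\<exists>!Y. transmission G S c x Y"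
proof (rule ex_ex1I)
  define out where "out v Y e = (\<Sum>e' \<in> in_ports G v. node_coeff c (e', e) * Y e') +
    (if v = S then \<Sum>i < dim_vec x. src_coeff c (i, e) * x $ i else 0)" for v Y e
  define inp where "inp Y e' = (\<Sum>e \<in> {e. (e, e') \<in> edges G}. Y e)" for Y :: "'b \<Rightarrow> 'c" and e'
  define step where "step Y p = (\<Sum>v \<in> {v \<in> nodes G. p \<in> out_ports G v}. out v Y p) +
    (\<Sum>v \<in> {v \<in> nodes G. p \<in> in_ports G v}. inp Y p)" for Y p
  have step_out: "step Y e = out v Y e" if "v \<in> nodes G" "e \<in> out_ports G v" for Y v e
  proof -
    have "w = v" if "w \<in> nodes G" "e \<in> out_ports G w" for w
      using disjoint_family_onD[OF disjoint_out_ports, of w v] that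
        \<open>v \<in> nodes G\<close> \<open>e \<in> out_ports G v\<close> by blast
    moreover have "e \<notin> in_ports G w" if "w \<in> nodes G" for w
      using disjoint_in_out_ports[of w v] that \<open>v \<in> nodes G\<close> \<open>e \<in> out_ports G v\<close> by blast
    ultimately have eq: "{w \<in> nodes G. e \<in> out_ports G w} = {v}"
      "{w \<in> nodes G. e \<in> in_ports G w} = {}"
      using that by blast+
    show ?thesis unfolding step_def eq by simp
  qed
  have step_in: "step Y e = inp Y e" if "v \<in> nodes G" "e \<in> in_ports G v" for Y v e
  proof -
    have "w = v" if "w \<in> nodes G" "e \<in> in_ports G w" for w
      using disjoint_family_onD[OF disjoint_in_ports, of w v] that
        \<open>v \<in> nodes G\<close> \<open>e \<in> in_ports G v\<close> by blast
    moreover have "e \<notin> out_ports G w" if "w \<in> nodes G" for w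
      using disjoint_in_out_ports[of v w] that \<open>v \<in> nodes G\<close> \<open>e \<in> in_ports G v\<close> by blast
    ultimately have eq: "{w \<in> nodes G. e \<in> in_ports G w} = {v}"
      "{w \<in> nodes G. e \<in> out_ports G w} = {}"
      using that by blast+
    show ?thesis unfolding step_def eq by simp
  qed
  have step_else: "step Y p = 0" if "p \<notin> (\<Union>v \<in> nodes G. in_ports G v \<union> out_ports G v)" for Y p
  proof -
    have eq: "{w \<in> nodes G. p \<in> in_ports G w} = {}" "{w \<in> nodes G. p \<in> out_ports G w} = {}"
      using that by blast+
    show ?thesis unfolding step_def eq by simp
  qed
  define Y where "Y n = (step ^^ n) (\<lambda>_. 0)" for n
  have Y_Suc: "Y (Suc n) = step (Y n)" for n
    by (simp add: Y_def)
  let ?stable = "\<lambda>p. \<forall>\<^sub>F n in sequentially. Y (Suc n) p = Y n p"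
  have node_stable: "\<forall>p \<in> in_ports G v \<union> out_ports G v. ?stable p" if "v \<in> nodes G" for v
    using wf_arcs that
  proof (induction v rule: wf_induct_rule)
    case (less w)
    have in_stable: "?stable e'" if "e' \<in> in_ports G w" for e'
    proof -
      have "?stable e" if edge: "(e, e') \<in> edges G" for e
      proof -
        obtain v where "v \<in> nodes G" "e \<in> out_ports G v" "(v, w) \<in> arcs G"
          by (rule edge_source[OF edge less.prems \<open>e' \<in> in_ports G w\<close>])
        with less.IH[of v] show ?thesis by blast
      qed
      then have "\<forall>\<^sub>F n in sequentially. \<forall>e \<in> {e. (e, e') \<in> edges G}. Y (Suc n) e = Y n e"
        by (intro eventually_ball_finite finite_edge_sources) auto
      then have "\<forall>\<^sub>F n in sequentially. step (Y (Suc n)) e' = step (Y n) e'"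
        by eventually_elim
          (auto simp: step_in[OF \<open>w \<in> nodes G\<close> that] inp_def intro!: sum.cong)
      then have "\<forall>\<^sub>F n in sequentially. Y (Suc (Suc n)) e' = Y (Suc n) e'"
        by (simp add: Y_Suc)
      then show ?thesis
        using eventually_sequentially_Suc[of "\<lambda>n. Y (Suc n) e' = Y n e'"] by simp
    qed
    have out_stable: "?stable e" if "e \<in> out_ports G w" for e
    proof -
      have "\<forall>\<^sub>F n in sequentially. \<forall>e' \<in> in_ports G w. Y (Suc n) e' = Y n e'"
        by (intro eventually_ball_finite finite_in_ports less.prems ballI in_stable)
      then have "\<forall>\<^sub>F n in sequentially. step (Y (Suc n)) e = step (Y n) e"
        by eventually_elim
          (auto simp: step_out[OF \<open>w \<in> nodes G\<close> that] out_def intro!: sum.cong)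
      then have "\<forall>\<^sub>F n in sequentially. Y (Suc (Suc n)) e = Y (Suc n) e"
        by (simp add: Y_Suc)
      then show ?thesis
        using eventually_sequentially_Suc[of "\<lambda>n. Y (Suc n) e = Y n e"] by simp
    qed
    show ?case using in_stable out_stable by blast
  qed
  have "\<forall>\<^sub>F n in sequentially. \<forall>p \<in> (\<Union>v \<in> nodes G. in_ports G v \<union> out_ports G v).
      Y (Suc n) p = Y n p"
    using node_stable finite_nodes finite_in_ports finite_out_ports
    by (intro eventually_ball_finite) auto
  then obtain n where n:
    "\<forall>p \<in> (\<Union>v \<in> nodes G. in_ports G v \<union> out_ports G v). Y (Suc n) p = Y n p"
    by (auto simp: eventually_sequentially)
  have "step (Y (Suc n)) = Y (Suc n)"
  proof
    fix p
    have eq: "step (Y (Suc n)) p = step (Y n) p"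
    proof (cases "p \<in> (\<Union>v \<in> nodes G. in_ports G v \<union> out_ports G v)")
      case True
      then consider (inp) v where "v \<in> nodes G" "p \<in> in_ports G v"
        | (out) v where "v \<in> nodes G" "p \<in> out_ports G v" by blast
      then show ?thesis
      proof cases
        case inp
        have "inp (Y (Suc n)) p = inp (Y n) p"
          unfolding inp_def using n edges_ports by (intro sum.cong) auto
        then show ?thesis by (simp add: step_in[OF inp])
      next
        case out
        have "out v (Y (Suc n)) p = out v (Y n) p"
          unfolding out_def using n out(1)
          by (intro arg_cong2[where f = "(+)"] sum.cong arg_cong2[where f = "(*)"]) auto
        then show ?thesis by (simp add: step_out[OF out])
      qed
    qed (simp add: step_else)
    then show "step (Y (Suc n)) p = Y (Suc n) p" by (simp add: Y_Suc)
  qed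
  then have "transmission G S c x (Y (Suc n))"
    unfolding transmission_def out_def[symmetric] inp_def[symmetric]
    using step_out[of _ _ "Y (Suc n)"] step_in[of _ _ "Y (Suc n)"] step_else[of _ "Y (Suc n)"]
    by simp
  then show "\<exists>Y. transmission G S c x Y" by blast
next
  fix Y Y' assume Y: "transmission G S c x Y" and Y': "transmission G S c x Y'"
  have node: "\<forall>p \<in> in_ports G v \<union> out_ports G v. Y p = Y' p" if "v \<in> nodes G" for v
    using wf_arcs that
  proof (induction v rule: wf_induct_rule)
    case (less w)
    have in_eq: "Y e' = Y' e'" if "e' \<in> in_ports G w" for e'
    proof -
      have "Y e = Y' e" if edge: "(e, e') \<in> edges G" for e
      proof -
        obtain v where "v \<in> nodes G" "e \<in> out_ports G v" "(v, w) \<in> arcs G"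
          by (rule edge_source[OF edge less.prems \<open>e' \<in> in_ports G w\<close>])
        with less.IH[of v] show ?thesis by blast
      qed
      then have "(\<Sum>e \<in> {e. (e, e') \<in> edges G}. Y e) = (\<Sum>e \<in> {e. (e, e') \<in> edges G}. Y' e)"
        by (intro sum.cong) auto
      then show ?thesis
        using Y Y' less.prems that by (simp add: transmission_def)
    qed
    have "Y e = Y' e" if "e \<in> out_ports G w" for e
    proof -
      have "(\<Sum>e' \<in> in_ports G w. node_coeff c (e', e) * Y e') =
          (\<Sum>e' \<in> in_ports G w. node_coeff c (e', e) * Y' e')"
        using in_eq by (intro sum.cong) auto
      then show ?thesis
        using Y Y' less.prems that by (simp add: transmission_def)
    qed
    with in_eq show ?case by blast
  qed
  show "Y = Y'"
  proof
    fix p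
    show "Y p = Y' p"
      using node Y Y' unfolding transmission_def
      by (cases "p \<in> (\<Union>v \<in> nodes G. in_ports G v \<union> out_ports G v)") auto
  qed
qed

end

(* The determinant of a system matrix is a polynomial function of the coefficients, and it is
   nonzero at some coding for each failure pattern and destination, namely at a solution. No
   multivariate polynomials are needed to find a common nonzero point: on the line through two
   codings the determinants are univariate polynomials, because the transmission equations make
   sense over the polynomial ring and evaluation is a ring homomorphism. The resulting coding is
   over a finite set, hence over the fixed field of a power of the Frobenius map. This power maps
   the transmission equations to themselves, so by uniqueness of the port symbols it also fixes
   the system matrices. *)
theory Submission
  imports Defs "Jordan_Normal_Form.Determinant"
begin

section \<open>Finite subfields of the algebraic closure of a finite field\<close>

text \<open>In a finite field, 1 plus the product of all X - a takes the value 1 everywhere. Having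
  no root, it would be constant, hence equal to 1, although the product is nonzero.\<close>

lemma infinite_UNIV_alg_closed: "infinite (UNIV :: 'a::alg_closed_field set)"
proof
  assume fin: "finite (UNIV :: 'a set)"
  define P :: "'a poly" where "P = 1 + (\<Prod>a\<in>UNIV. [:-a, 1:])"
  have val: "poly P x = 1" for x
    using fin by (simp add: P_def poly_prod prod_zero_iff)
  have "P \<noteq> 1"
    using fin by (simp add: P_def prod_zero_iff)
  moreover have "degree P = 0"
    using alg_closed_imp_poly_has_root[of P] val by (metis bot_nat_0.not_eq_extremum zero_neq_one)
  then obtain a where "P = [:a:]"
    by (rule degree_eq_zeroE)
  ultimately show False
    using val[of 0] by (simp add: one_pCons)
qed

section \<open>Elements fixed by powers of the Frobenius map\<close>

lemma inj_power_CHAR_power: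
  fixes x y :: "'a :: field"
  assumes "prime CHAR('a)" "x ^ (CHAR('a) ^ n) = y ^ (CHAR('a) ^ n)"
  shows "x = y"
proof -
  have "x ^ (CHAR('a) ^ n) = (x - y) ^ (CHAR('a) ^ n) + y ^ (CHAR('a) ^ n)"
    using freshmans_dream'[OF assms(1) refl, of "x - y" y n] by simp
  then have "(x - y) ^ (CHAR('a) ^ n) = 0"
    using assms(2) by simp
  then show ?thesis by simp
qed

lemma power_power_fixed:
  fixes x :: "'a :: monoid_mult"
  assumes "x ^ (p ^ n) = x"
  shows "x ^ (p ^ (n * k)) = x"
proof (induction k)
  case (Suc k)
  have "x ^ (p ^ (n * Suc k)) = (x ^ (p ^ n)) ^ (p ^ (n * k))"
    by (simp add: power_add power_mult[symmetric])
  then show ?case using Suc assms by simp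
qed simp

text \<open>Pigeonhole on the orbit of \<open>x\<close> under the \<open>n\<close>-th Frobenius
  power gives two equal iterates; injectivity cancels the preperiod, so \<open>x\<close> itself is
  periodic.\<close>

lemma ex_power_CHAR_fixed:
  fixes x :: "'a :: field"
  assumes "prime CHAR('a)" "0 < n" "finite A" "\<And>i. x ^ (CHAR('a) ^ (n * i)) \<in> A"
  shows "\<exists>k>0. x ^ (CHAR('a) ^ k) = x"
proof -
  let ?g = "\<lambda>i::nat. x ^ (CHAR('a) ^ (n * i))"
  have "\<not> inj ?g"
    using assms(3,4) by (meson finite_subset image_subsetI infinite_UNIV_nat finite_imageD)
  then obtain i j where "i < j" and eq: "?g i = ?g j"
    unfolding inj_def by (metis nat_neq_iff)
  then obtain d where d: "j = i + d" "0 < d"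
    by (metis less_imp_add_positive)
  have "?g j = (x ^ (CHAR('a) ^ (n * d))) ^ (CHAR('a) ^ (n * i))"
    by (simp add: d(1) power_mult[symmetric] power_add[symmetric] distrib_left add.commute)
  then have "x = x ^ (CHAR('a) ^ (n * d))"
    using eq by (metis inj_power_CHAR_power[OF assms(1)])
  then show ?thesis using assms(2) d(2) by (intro exI[of _ "n * d"]) simp
qed

lemma common_power_fixed:
  fixes A :: "'a :: monoid_mult set"
  assumes "finite A" "\<And>x. x \<in> A \<Longrightarrow> \<exists>n>0. x ^ (p ^ n) = x"
  shows "\<exists>n>0. \<forall>x\<in>A. x ^ (p ^ n) = x"
  using assms
proof (induction A)
  case (insert a A)
  then obtain m n where "0 < m" "a ^ (p ^ m) = a" "0 < n" "\<forall>x\<in>A. x ^ (p ^ n) = x"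
    by (metis insertI1 insertI2)
  \<comment> \<open>The product of two periods is a period of both.\<close>
  then show ?case
    using power_power_fixed[of _ p m n] power_power_fixed[of _ p n m]
    by (intro exI[of _ "m * n"]) (auto simp: mult.commute)
qed auto

text \<open>A Frobenius power is a ring homomorphism, so it commutes with evaluation once it fixes
  the coefficients; in particular it maps roots of \<open>P\<close> to roots.\<close>

lemma poly_power_CHAR_power:
  fixes x :: "'a :: field"
  assumes "prime CHAR('a)" "\<And>i. coeff P i ^ (CHAR('a) ^ n) = coeff P i"
  shows "poly P (x ^ (CHAR('a) ^ n)) = poly P x ^ (CHAR('a) ^ n)"
  using assms(2)
  by (simp add: poly_altdef freshmans_dream_sum'[OF assms(1) refl] power_mult_distrib
      power_mult[symmetric] mult.commute)

lemma prime_CHAR_alg_closure: "prime CHAR('q::finite_field alg_closure)"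
  by (simp add: prime_CHAR_semidom finite_imp_CHAR_pos)

text \<open>Every element is a root of a nonzero polynomial over the base field. A Frobenius power
  fixing the base field maps the finitely many roots to roots, so each root is periodic.\<close>

lemma alg_closure_finite_field_power_fixed:
  fixes x :: "'q::finite_field alg_closure"
  shows "\<exists>n>0. x ^ (CHAR('q) ^ n) = x"
proof -
  let ?p = "CHAR('q alg_closure)"
  note prime = prime_CHAR_alg_closure[where ?'q = 'q]
  \<comment> \<open>The finite base field is closed under powers, so it contains the whole Frobenius
    orbit of \<open>y\<close>.\<close>
  have base: "\<exists>n>0. y ^ (?p ^ n) = y" if "y \<in> range to_ac" for y :: "'q alg_closure"
    using that
    by (intro ex_power_CHAR_fixed[OF prime, of 1 "range to_ac"])
      (auto simp flip: to_ac_power)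
  obtain n where n: "0 < n" "\<forall>y \<in> range (to_ac :: 'q \<Rightarrow> _). y ^ (?p ^ n) = y"
    using common_power_fixed[OF finite_imageI[OF finite_UNIV] base] by blast
  obtain P :: "'q poly" where P: "P \<noteq> 0" "poly (map_poly to_ac P) x = 0"
    by (rule alg_closure_algebraic)
  let ?P = "map_poly to_ac P"
  have "?P \<noteq> 0"
    using P(1) by (simp add: map_poly_eq_0_iff)
  have "poly ?P (x ^ (?p ^ (n * i))) = 0" for i
    using n(2) P(2) prime
    by (subst poly_power_CHAR_power[OF prime]) (auto simp: coeff_map_poly power_power_fixed
        simp del: CHAR_alg_closure)
  then show ?thesis
    using ex_power_CHAR_fixed[OF prime n(1), of "{y. poly ?P y = 0}" x] \<open>?P \<noteq> 0\<close>
    by (simp add: poly_roots_finite)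
qed

text \<open>Take the fixed field of a Frobenius power that fixes \<open>A\<close> and the base
  field. The map \<open>h\<close> is returned too, so that membership in the field can be proved by
  invariance under \<open>h\<close>.\<close>

lemma finite_extension_field_fixed_points:
  fixes A :: "'q::finite_field alg_closure set"
  assumes "finite A"
  obtains h :: "'q alg_closure \<Rightarrow> 'q alg_closure" where "comm_ring_hom h"
    "finite_extension_field {x. h x = x}" "A \<subseteq> {x. h x = x}"
proof -
  let ?p = "CHAR('q alg_closure)"
  note prime = prime_CHAR_alg_closure[where ?'q = 'q]
  obtain n where n: "0 < n" "\<forall>x \<in> A \<union> range to_ac. x ^ (?p ^ n) = x"
    using common_power_fixed[of "A \<union> range to_ac" ?p] assms
      alg_closure_finite_field_power_fixed[where ?'q = 'q] by auto
  define m where "m = ?p ^ n"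
  have m: "1 < m"
    unfolding m_def by (rule one_less_power[OF prime_gt_1_nat[OF prime] n(1)])
  define h where "h x = x ^ m" for x :: "'q alg_closure"
  have "(x + y) ^ m = x ^ m + y ^ m" for x y :: "'q alg_closure"
    unfolding m_def by (rule freshmans_dream'[OF prime refl])
  then interpret h: comm_ring_hom h
    using m by unfold_locales (auto simp: h_def power_mult_distrib)
  let ?K = "{x. h x = x}"
  have "finite ?K"
  proof (rule finite_subset)
    show "?K \<subseteq> {x. poly (monom 1 m - [:0, 1:]) x = 0}"
      by (auto simp: h_def poly_monom)
    \<comment> \<open>Since \<open>1 < m\<close>, the leading term of X^m - X survives, so the
      polynomial is nonzero and has finitely many roots.\<close>
    have "coeff (monom 1 m - [:0, 1 :: 'q alg_closure:]) m = 1"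
      using m by (simp add: coeff_pCons split: nat.splits)
    then show "finite {x. poly (monom 1 m - [:0, 1 :: 'q alg_closure:]) x = 0}"
      by (intro poly_roots_finite) (metis coeff_0 zero_neq_one)
  qed
  moreover have "subfield ?K ring_of_type_algebra"
  proof -
    let ?R = "ring_of_type_algebra :: 'q alg_closure ring"
    interpret R: field ?R by (rule field_from_type_algebra)
    have ops: "carrier ?R = UNIV" "\<zero>\<^bsub>?R\<^esub> = 0" "\<one>\<^bsub>?R\<^esub> = 1"
      "x \<otimes>\<^bsub>?R\<^esub> y = x * y" "x \<oplus>\<^bsub>?R\<^esub> y = x + y" for x y
      by (simp_all add: ring_of_type_algebra_def)
    have neg: "\<ominus>\<^bsub>?R\<^esub> x = - x" for x
      by (rule sym, rule R.sum_zero_eq_neg) (simp_all add: ops)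
    have inv: "inv\<^bsub>?R\<^esub> x = inverse x" if "x \<noteq> 0" for x
      using that by (intro R.inv_char) (simp_all add: ops)
    show ?thesis
    proof (rule R.subfieldI'[OF R.subringI])
      fix k assume "k \<in> ?K - {\<zero>\<^bsub>?R\<^esub>}"
      then show "inv\<^bsub>?R\<^esub> k \<in> ?K"
        by (subst inv) (simp_all add: ops h_def power_inverse)
    qed (simp_all add: ops neg h.hom_uminus h.hom_mult h.hom_add)
  qed
  ultimately show ?thesis
    using n(2) by (intro that[of h] h.comm_ring_hom_axioms)
      (auto simp: finite_extension_field_def h_def m_def)
qed


section \<open>System matrices under ring homomorphisms\<close>

definition map_coding :: "('k \<Rightarrow> 'l) \<Rightarrow> ('v, 'p, 'k) coding \<Rightarrow> ('v, 'p, 'l) coding" where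
  "map_coding h c =
     \<lparr>src_coeff = h \<circ> src_coeff c, node_coeff = h \<circ> node_coeff c, dest_coeff = h \<circ> dest_coeff c\<rparr>"

lemma map_coding_id:
  assumes "coding_over {x. h x = x} c"
  shows "map_coding h c = c"
  using assms by (cases c) (simp add: map_coding_def coding_over_def fun_eq_iff image_subset_iff)

text \<open>The equations involve only ring operations, which \<open>hom\<close> preserves. This
  serves both evaluation of polynomials and Frobenius powers.\<close>

lemma (in comm_ring_hom) transmission_map_coding:
  assumes "transmission G S c x Y"
  shows "transmission G S (map_coding hom c) (map_vec hom x) (hom \<circ> Y)"
  unfolding transmission_def
proof (intro conjI ballI allI impI)
  fix v e assume "v \<in> nodes G" "e \<in> out_ports G v"
  with assms have "Y e = (\<Sum>e' \<in> in_ports G v. node_coeff c (e', e) * Y e') +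
      (if v = S then \<Sum>i < dim_vec x. src_coeff c (i, e) * x $ i else 0)"
    unfolding transmission_def by blast
  then show "(hom \<circ> Y) e =
      (\<Sum>e' \<in> in_ports G v. node_coeff (map_coding hom c) (e', e) * (hom \<circ> Y) e') +
      (if v = S then \<Sum>i < dim_vec (map_vec hom x).
         src_coeff (map_coding hom c) (i, e) * map_vec hom x $ i else 0)"
    by (simp add: map_coding_def hom_distribs)
next
  fix v e' assume "v \<in> nodes G" "e' \<in> in_ports G v"
  with assms have "Y e' = (\<Sum>e \<in> {e. (e, e') \<in> edges G}. Y e)"
    unfolding transmission_def by blast
  then show "(hom \<circ> Y) e' = (\<Sum>e \<in> {e. (e, e') \<in> edges G}. (hom \<circ> Y) e)"
    by (simp add: hom_distribs)
next
  fix p assume "p \<notin> (\<Union>v\<in>nodes G. in_ports G v \<union> out_ports G v)"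
  with assms have "Y p = 0"
    unfolding transmission_def by blast
  then show "(hom \<circ> Y) p = 0" by simp
qed

text \<open>Row \<open>i\<close> is the response to the \<open>i\<close>-th unit vector. This makes
  sense over any commutative ring, in particular over polynomials.\<close>

definition system_matrix ::
  "('v, 'p) network \<Rightarrow> 'v \<Rightarrow> nat \<Rightarrow> ('v, 'p, 'k::comm_ring_1) coding \<Rightarrow> 'v \<Rightarrow> 'k mat"
where
  "system_matrix G S \<mu> c t = mat \<mu> \<mu> (\<lambda>(i, k). received G S c t (unit_vec \<mu> i) $ k)"

lemma system_matrix_carrier [simp]: "system_matrix G S \<mu> c t \<in> carrier_mat \<mu> \<mu>"
  by (simp add: system_matrix_def)

context acyclic_network
begin

lemma transmission_port_symbols: "transmission G S c x (port_symbols G S c x)"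
  unfolding port_symbols_def by (rule theI'[OF ex1_transmission])

lemma port_symbols_eqI: "transmission G S c x Y \<Longrightarrow> port_symbols G S c x = Y"
  using transmission_port_symbols ex1_transmission by blast

text \<open>Superposition: the combination of the responses to the unit vectors satisfies the
  equations for \<open>x\<close>, so uniqueness applies.\<close>

lemma port_symbols_sum:
  "port_symbols G S c x p =
     (\<Sum>i < dim_vec x. x $ i * port_symbols G S c (unit_vec (dim_vec x) i) p)"
proof -
  let ?Y = "\<lambda>i. port_symbols G S c (unit_vec (dim_vec x) i)"
  have Y: "transmission G S c (unit_vec (dim_vec x) i) (?Y i)" for i
    by (rule transmission_port_symbols)
  have "transmission G S c x (\<lambda>p. \<Sum>i < dim_vec x. x $ i * ?Y i p)"
    unfolding transmission_def
  proof (intro conjI ballI allI impI)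
    fix v e assume v: "v \<in> nodes G" "e \<in> out_ports G v"
    have unit: "(\<Sum>j < dim_vec x. src_coeff c (j, e) * unit_vec (dim_vec x) i $ j) =
        src_coeff c (i, e)" if "i < dim_vec x" for i
    proof -
      have "(\<Sum>j < dim_vec x. src_coeff c (j, e) * unit_vec (dim_vec x) i $ j) =
          (\<Sum>j < dim_vec x. if j = i then src_coeff c (j, e) else 0)"
        using that by (intro sum.cong) auto
      then show ?thesis using that by simp
    qed
    have Ye: "?Y i e = (\<Sum>e' \<in> in_ports G v. node_coeff c (e', e) * ?Y i e') +
        (if v = S then src_coeff c (i, e) else 0)" if "i < dim_vec x" for i
      using Y[of i] v unit[OF that] unfolding transmission_def by simp
    have "(\<Sum>i < dim_vec x. x $ i * ?Y i e) =
        (\<Sum>i < dim_vec x. \<Sum>e' \<in> in_ports G v. node_coeff c (e', e) * (x $ i * ?Y i e')) +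
        (\<Sum>i < dim_vec x. if v = S then src_coeff c (i, e) * x $ i else 0)"
      unfolding sum.distrib[symmetric]
      by (intro sum.cong refl) (simp add: Ye distrib_left sum_distrib_left mult_ac)
    also have "(\<Sum>i < dim_vec x. \<Sum>e' \<in> in_ports G v. node_coeff c (e', e) * (x $ i * ?Y i e')) =
        (\<Sum>e' \<in> in_ports G v. node_coeff c (e', e) * (\<Sum>i < dim_vec x. x $ i * ?Y i e'))"
      by (subst sum.swap) (simp add: sum_distrib_left)
    finally show "(\<Sum>i < dim_vec x. x $ i * ?Y i e) =
        (\<Sum>e' \<in> in_ports G v. node_coeff c (e', e) * (\<Sum>i < dim_vec x. x $ i * ?Y i e')) +
        (if v = S then \<Sum>i < dim_vec x. src_coeff c (i, e) * x $ i else 0)"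
      by simp
  next
    fix v e' assume "v \<in> nodes G" "e' \<in> in_ports G v"
    then have Ye: "?Y i e' = (\<Sum>e \<in> {e. (e, e') \<in> edges G}. ?Y i e)" for i
      using Y[of i] unfolding transmission_def by blast
    show "(\<Sum>i < dim_vec x. x $ i * ?Y i e') =
        (\<Sum>e \<in> {e. (e, e') \<in> edges G}. \<Sum>i < dim_vec x. x $ i * ?Y i e)"
      by (subst sum.swap) (simp add: Ye sum_distrib_left)
  next
    fix p assume "p \<notin> (\<Union>v\<in>nodes G. in_ports G v \<union> out_ports G v)"
    then have "?Y i p = 0" for i
      using Y[of i] unfolding transmission_def by blast
    then show "(\<Sum>i < dim_vec x. x $ i * ?Y i p) = 0" by simp
  qed
  then show ?thesis by (simp add: port_symbols_eqI)
qed

lemma received_system_matrix: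
  assumes "x \<in> carrier_vec \<mu>"
  shows "received G S c t x = (system_matrix G S \<mu> c t)\<^sup>T *\<^sub>v x"
proof (rule eq_vecI)
  let ?Y = "\<lambda>i. port_symbols G S c (unit_vec \<mu> i)"
  fix k assume "k < dim_vec ((system_matrix G S \<mu> c t)\<^sup>T *\<^sub>v x)"
  then have k: "k < \<mu>" by (simp add: system_matrix_def)
  have "received G S c t x $ k =
      (\<Sum>e' \<in> in_ports G t. dest_coeff c (e', (t, k)) * (\<Sum>i < \<mu>. x $ i * ?Y i e'))"
    using assms k by (simp add: received_def port_symbols_sum[of S c x])
  also have "\<dots> =
      (\<Sum>i < \<mu>. (\<Sum>e' \<in> in_ports G t. dest_coeff c (e', (t, k)) * ?Y i e') * x $ i)"
    by (simp add: sum_distrib_left sum_distrib_right mult_ac sum.swap[of _ "in_ports G t"])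
  also have "\<dots> = ((system_matrix G S \<mu> c t)\<^sup>T *\<^sub>v x) $ k"
    using assms k
    by (simp add: system_matrix_def scalar_prod_def received_def atLeast0LessThan)
  finally show "received G S c t x $ k = ((system_matrix G S \<mu> c t)\<^sup>T *\<^sub>v x) $ k" .
qed (use assms in \<open>simp add: received_def system_matrix_def\<close>)

text \<open>The image under \<open>h\<close> of the port symbols solves the equations of the mapped
  coding, and \<open>h\<close> fixes the unit vectors, so uniqueness applies.\<close>

lemma system_matrix_map_coding:
  assumes "comm_ring_hom h"
  shows "system_matrix G S \<mu> (map_coding h c) t = map_mat h (system_matrix G S \<mu> c t)"
proof -
  interpret comm_ring_hom h by fact
  have unit: "map_vec h (unit_vec \<mu> i) = unit_vec \<mu> i" for i
    by (rule eq_vecI) (auto simp: unit_vec_def)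
  have "port_symbols G S (map_coding h c) (unit_vec \<mu> i) = h \<circ> port_symbols G S c (unit_vec \<mu> i)"
    for i
    using transmission_map_coding[OF transmission_port_symbols, of S c "unit_vec \<mu> i"]
    by (simp add: unit port_symbols_eqI)
  then show ?thesis
    by (intro eq_matI) (auto simp: system_matrix_def received_def map_coding_def hom_distribs)
qed

text \<open>As \<open>h\<close> fixes the coding, it fixes the matrix; thus the entries lie in the
  fixed set without following symbols through the network.\<close>

lemma is_system_matrix_system_matrix:
  assumes "comm_ring_hom h" "coding_over {x. h x = x} c"
  shows "is_system_matrix {x. h x = x} G S \<mu> c t (system_matrix G S \<mu> c t)"
proof -
  let ?M = "system_matrix G S \<mu> c t"
  have "map_mat h ?M = ?M"
    using system_matrix_map_coding[OF assms(1), of S \<mu> c t] by (simp add: map_coding_id[OF assms(2)])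
  then have "h (?M $$ (i, j)) = ?M $$ (i, j)" if "i < \<mu>" "j < \<mu>" for i j
    using that system_matrix_carrier[of G S \<mu> c t] by (metis carrier_matD index_map_mat(1))
  moreover have "dim_row ?M = \<mu>" "dim_col ?M = \<mu>"
    by (simp_all add: system_matrix_def)
  ultimately show ?thesis
    by (auto simp: is_system_matrix_def received_system_matrix dest!: elements_matD)
qed

lemma system_matrix_eq_1:
  assumes "\<And>i. i < \<mu> \<Longrightarrow> received G S c t (unit_vec \<mu> i) = unit_vec \<mu> i"
  shows "system_matrix G S \<mu> c t = 1\<^sub>m \<mu>"
  using assms by (intro eq_matI) (auto simp: system_matrix_def)

end


section \<open>Codings outside finitely many hypersurfaces\<close>

text \<open>The affine line through \<open>c\<close> and \<open>d\<close>, with the polynomial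
  variable as parameter: 0 gives \<open>c\<close> and 1 gives \<open>d\<close>.\<close>

definition line_coding ::
  "('v, 'p, 'k::comm_ring_1) coding \<Rightarrow> ('v, 'p, 'k) coding \<Rightarrow> ('v, 'p, 'k poly) coding"
where
  "line_coding c d =
     \<lparr>src_coeff = \<lambda>a. [:src_coeff c a, src_coeff d a - src_coeff c a:],
      node_coeff = \<lambda>a. [:node_coeff c a, node_coeff d a - node_coeff c a:],
      dest_coeff = \<lambda>a. [:dest_coeff c a, dest_coeff d a - dest_coeff c a:]\<rparr>"

lemma map_coding_line_coding:
  shows map_coding_line_coding_0: "map_coding (\<lambda>p. poly p 0) (line_coding c d) = c"
    and map_coding_line_coding_1: "map_coding (\<lambda>p. poly p 1) (line_coding c d) = d"
  by (cases c; cases d; simp add: map_coding_def line_coding_def fun_eq_iff)+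

text \<open>The image set is finite for finite \<open>A\<close> and \<open>B\<close>, so each point
  of the line again has finitely many coefficient values.\<close>

lemma coding_over_line_coding:
  assumes "coding_over A c" "coding_over B d"
  shows "coding_over ((\<lambda>(a, b). a + t * (b - a)) ` (A \<times> B))
    (map_coding (\<lambda>p. poly p t) (line_coding c d))"
proof -
  have "a + t * (b - a) \<in> (\<lambda>(a, b). a + t * (b - a)) ` (A \<times> B)" if "a \<in> A" "b \<in> B" for a b
    using that by (intro image_eqI[of _ _ "(a, b)"]) auto
  then show ?thesis
    using assms by (simp add: coding_over_def map_coding_def line_coding_def image_subset_iff)
qed

text \<open>
  The maps \<open>g j\<close> are polynomial functions of the coding in the sense that they extend to
  codings over \<open>'k poly\<close> compatibly with evaluation. The set \<open>A\<close> is needed because a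
  coding may have infinitely many coefficients.
\<close>

lemma ex_common_nonzero_coding:
  fixes g :: "'j \<Rightarrow> ('v, 'p, 'k::field) coding \<Rightarrow> 'k"
    and P :: "'j \<Rightarrow> ('v, 'p, 'k poly) coding \<Rightarrow> 'k poly"
  assumes inf: "infinite (UNIV :: 'k set)" and "finite J"
    and "\<And>j c t. j \<in> J \<Longrightarrow> g j (map_coding (\<lambda>p. poly p t) c) = poly (P j c) t"
    and "\<And>j. j \<in> J \<Longrightarrow> \<exists>A c. finite A \<and> coding_over A c \<and> g j c \<noteq> 0"
  shows "\<exists>A c. finite A \<and> coding_over A c \<and> (\<forall>j\<in>J. g j c \<noteq> 0)"
  using assms(2-)
proof (induction J)
  case empty
  let ?c = "\<lparr>src_coeff = \<lambda>_. 0, node_coeff = \<lambda>_. 0, dest_coeff = \<lambda>_. 0\<rparr> :: ('v, 'p, 'k) coding"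
  have "coding_over {0} ?c" by (auto simp: coding_over_def)
  then show ?case by blast
next
  case (insert k J)
  then obtain A c where c: "finite A" "coding_over A c" "\<And>j. j \<in> J \<Longrightarrow> g j c \<noteq> 0"
    by (metis insertI2)
  obtain B d where d: "finite B" "coding_over B d" "g k d \<noteq> 0"
    using insert.prems(2)[of k] by blast
  define Q where "Q j = P j (line_coding c d)" for j
  have Q: "g j (map_coding (\<lambda>p. poly p t) (line_coding c d)) = poly (Q j) t"
    if "j \<in> insert k J" for j t
    unfolding Q_def by (rule insert.prems(1)[OF that])
  \<comment> \<open>Each \<open>Q j\<close> is nonzero at one end of the line: at 1 for the new
    index \<open>k\<close>, at 0 for the indices in \<open>J\<close>.\<close>
  have "Q j \<noteq> 0" if "j \<in> insert k J" for j
  proof (cases "j = k")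
    case True
    then have "poly (Q j) 1 \<noteq> 0"
      using Q[OF that, of 1] d(3) by (simp add: map_coding_line_coding_1)
    then show ?thesis by auto
  next
    case False
    then have "poly (Q j) 0 \<noteq> 0"
      using Q[OF that, of 0] c(3)[of j] that by (simp add: map_coding_line_coding_0)
    then show ?thesis by auto
  qed
  \<comment> \<open>Finitely many nonzero polynomials have finitely many roots in total, so the
    infinite field contains a parameter avoiding them all.\<close>
  then have "finite (\<Union>j \<in> insert k J. {t. poly (Q j) t = 0})"
    using insert.hyps(1) by (intro finite_UN_I poly_roots_finite) auto
  then obtain t where "t \<notin> (\<Union>j \<in> insert k J. {t. poly (Q j) t = 0})"
    using inf by (metis ex_new_if_finite)
  then have "\<forall>j \<in> insert k J. g j (map_coding (\<lambda>p. poly p t) (line_coding c d)) \<noteq> 0"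
    using Q by auto
  moreover have "finite ((\<lambda>(a, b). a + t * (b - a)) ` (A \<times> B))"
    using c(1) d(1) by simp
  ultimately show ?case
    using coding_over_line_coding[OF c(2) d(2), of t] by (intro exI conjI)
qed

section \<open>Static solution from nonvanishing determinants\<close>

lemma invertible_mat_det:
  fixes M :: "'k::field mat"
  assumes "M \<in> carrier_mat n n" "det M \<noteq> 0"
  shows "invertible_mat M"
  using det_non_zero_imp_unit[OF assms, of "()"] assms(1)
  by (auto simp: Units_def ring_mat_def invertible_mat_def inverts_mat_def)

lemma (in network) finite_edges: "finite (edges G)"
  using finite_subset[OF edges_ports] finite_nodes finite_in_ports finite_out_ports by blast

theorem theorem11:
  fixes G :: "('v, 'p) network" and S :: 'v and \<mu> N :: nat and T :: "nat \<Rightarrow> 'v"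
  assumes "multicast G S \<mu> T N"
  shows "\<exists>(K :: 'q::finite_field alg_closure set) c.
           finite_extension_field K \<and> coding_over K c \<and>
           (\<forall>f \<in> solvable_failures TYPE('q) G S \<mu> T N. \<forall>i \<in> {1..N}.
              \<exists>M. is_system_matrix K (delete_edges f G) S \<mu> c (T i) M \<and> invertible_mat M)"
proof -
  interpret multicast G S \<mu> T N by fact
  let ?F = "solvable_failures TYPE('q) G S \<mu> T N"
  let ?M = "\<lambda>j c. system_matrix (delete_edges (fst j) G) S \<mu> c (T (snd j))"
  note [intro] = acyclic_network_delete_edges
  have "\<exists>A (c :: ('v, 'p, 'q alg_closure) coding). finite A \<and> coding_over A c \<and>
      (\<forall>j \<in> ?F \<times> {1..N}. det (?M j c) \<noteq> 0)"
  proof (rule ex_common_nonzero_coding)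
    \<comment> \<open>Only finitely many determinants occur, because failure patterns are subsets of
      a finite edge set.\<close>
    have "?F \<subseteq> Pow (edges G)" by (auto simp: solvable_failures_def)
    then show "finite (?F \<times> {1..N})"
      using finite_edges by (auto intro: finite_subset)
  next
    fix j :: "('p \<times> 'p) set \<times> nat" and c :: "('v, 'p, 'q alg_closure poly) coding" and t
    interpret eval: comm_ring_hom "\<lambda>p :: 'q alg_closure poly. poly p t"
      by unfold_locales auto
    show "det (?M j (map_coding (\<lambda>p. poly p t) c)) = poly (det (?M j c)) t"
      by (simp add: acyclic_network.system_matrix_map_coding[OF acyclic_network_delete_edges
            eval.comm_ring_hom_axioms])
  next
    fix j assume j: "j \<in> ?F \<times> {1..N}"
    then obtain K :: "'q alg_closure set" and c :: "('v, 'p, 'q alg_closure) coding"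
      where K: "finite_extension_field K" "coding_over K c"
        and c: "\<forall>x \<in> carrier_vec \<mu>. set\<^sub>v x \<subseteq> K \<longrightarrow>
          received (delete_edges (fst j) G) S c (T (snd j)) x = x"
      unfolding solvable_failures_def solvable_def by fastforce
    \<comment> \<open>Solvability speaks only of source vectors over \<open>K\<close>. As 0 and 1
      lie in \<open>K\<close>, it applies to the unit vectors and makes the system matrix the
      identity.\<close>
    have "range (to_ac :: 'q \<Rightarrow> _) \<subseteq> K"
      using K(1) by (simp add: finite_extension_field_def)
    then have "{0, 1} \<subseteq> K"
      by (metis empty_subsetI insert_subset range_subsetD to_ac_0 to_ac_1)
    then have "set\<^sub>v (unit_vec \<mu> i) \<subseteq> K" for i
      by (auto simp: vec_set_def unit_vec_def)
    then have "?M j c = 1\<^sub>m \<mu>"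
      using c by (intro acyclic_network.system_matrix_eq_1) auto
    then show "\<exists>A (c :: ('v, 'p, 'q alg_closure) coding). finite A \<and> coding_over A c \<and> det (?M j c) \<noteq> 0"
      using K by (intro exI[of _ K] exI[of _ c]) (simp add: finite_extension_field_def)
  qed (rule infinite_UNIV_alg_closed)
  then obtain A and c :: "('v, 'p, 'q alg_closure) coding"
    where c: "finite A" "coding_over A c" "\<forall>j \<in> ?F \<times> {1..N}. det (?M j c) \<noteq> 0"
    by blast
  \<comment> \<open>The coefficients lie in a finite set that need not be a field; it is enlarged to
    a finite extension field.\<close>
  obtain h :: "'q alg_closure \<Rightarrow> 'q alg_closure" where h: "comm_ring_hom h"
    "finite_extension_field {x. h x = x}" "A \<subseteq> {x. h x = x}"
    by (rule finite_extension_field_fixed_points[OF c(1)])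
  have over: "coding_over {x. h x = x} c"
    using c(2) h(3) by (auto simp: coding_over_def)
  show ?thesis
  proof (intro exI[of _ "{x. h x = x}"] exI[of _ c] conjI ballI)
    fix f i assume "f \<in> ?F" "i \<in> {1..N}"
    then have "det (?M (f, i) c) \<noteq> 0"
      using c(3) by blast
    then have "invertible_mat (?M (f, i) c)"
      by (rule invertible_mat_det[OF system_matrix_carrier])
    moreover have "is_system_matrix {x. h x = x} (delete_edges f G) S \<mu> c (T i) (?M (f, i) c)"
      using acyclic_network.is_system_matrix_system_matrix[OF acyclic_network_delete_edges h(1) over]
      by simp
    ultimately show "\<exists>M. is_system_matrix {x. h x = x} (delete_edges f G) S \<mu> c (T i) M \<and>
        invertible_mat M" by blast
  qed (use h over in auto)
qed

end
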